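(* If $\lambda$ is a self-conjugate (i.e. $\lambda=\lambda'$) wide partition with at most three distinct part sizes, then $\lambda$ is Latin.
   Context: For partitions $\alpha,\beta$ of the same integer, $\alpha\ge\beta$ (dominance) means $\sum_{k\le j}\alpha_k\ge\sum_{k\le j}\beta_k$ for all $j$; $\mu'$ is the conjugate of $\mu$. $\mu$ is a subpartition of $\lambda$ if the multiset of parts of $\mu$ is a submultiset of that of $\lambda$. $\lambda$ is wide if $\mu\ge\mu'$ for every subpartition $\mu$ of $\lambda$. A tableau of shape $\lambda$ is the Young diagram of $\lambda$ with a positive integer in each cell. $\lambda$ is Latin if there is a tableau of shape $\lambda$ in which no two cells in the same row or column have equal entries and in which, for every $i$, the integer $i$ occurs exactly $\lambda'_i$ times. *)

theory Defs
  imports "HOL-Library.Multiset"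
begin

text \<open>A partition is the weakly decreasing list of its (positive) parts. Rows, columns and parts
  are indexed from 0, so \<open>part la k\<close> is \<open>\<lambda>\<^bsub>k+1\<^esub>\<close> in the usual
  notation, with \<open>\<lambda>\<^bsub>k+1\<^esub> = 0\<close> beyond the last part.\<close>

definition is_partition :: "nat list \<Rightarrow> bool" where
  "is_partition la \<longleftrightarrow> sorted_wrt (\<ge>) la \<and> (\<forall>p\<in>set la. p > 0)"

definition part :: "nat list \<Rightarrow> nat \<Rightarrow> nat" where
  "part la k = (if k < length la then la ! k else 0)"

definition conjugate :: "nat list \<Rightarrow> nat list" where
  "conjugate la = map (\<lambda>c. card {r. c < part la r}) [0..<part la 0]"

definition dominates :: "nat list \<Rightarrow> nat list \<Rightarrow> bool" where
  "dominates al be \<longleftrightarrow> sum_list al = sum_list be \<and>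
     (\<forall>j. (\<Sum>k<j. part be k) \<le> (\<Sum>k<j. part al k))"

definition subpartition :: "nat list \<Rightarrow> nat list \<Rightarrow> bool" where
  "subpartition mu la \<longleftrightarrow> is_partition mu \<and> mset mu \<subseteq># mset la"

definition wide :: "nat list \<Rightarrow> bool" where
  "wide la \<longleftrightarrow> (\<forall>mu. subpartition mu la \<longrightarrow> dominates mu (conjugate mu))"

definition young_diagram :: "nat list \<Rightarrow> (nat \<times> nat) set" where
  "young_diagram la = {(r, c). r < length la \<and> c < part la r}"

text \<open>Values of a tableau outside the diagram are irrelevant.\<close>

definition is_tableau :: "nat list \<Rightarrow> (nat \<times> nat \<Rightarrow> nat) \<Rightarrow> bool" where
  "is_tableau la T \<longleftrightarrow> (\<forall>x\<in>young_diagram la. T x > 0)"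

definition latin :: "nat list \<Rightarrow> bool" where
  "latin la \<longleftrightarrow> (\<exists>T. is_tableau la T \<and>
     (\<forall>x\<in>young_diagram la. \<forall>y\<in>young_diagram la.
        x \<noteq> y \<and> (fst x = fst y \<or> snd x = snd y) \<longrightarrow> T x \<noteq> T y) \<and>
     (\<forall>i\<ge>1. card {x \<in> young_diagram la. T x = i} = part (conjugate la) (i - 1)))"

end

theory Submission
  imports Defs
begin

text \<open>
  A self-conjugate partition with at most three part sizes has \<open>x\<close> rows of length \<open>x + y + z\<close>, then
  \<open>y\<close> rows of length \<open>x + y\<close>, then \<open>z\<close> rows of length \<open>x\<close>. Dominance for the subpartition of the
  shorter rows gives \<open>z \<le> x\<close> and \<open>y (x - y) \<le> x (x - z)\<close>.

  A Latin tableau of this shape is the same as a set of triples (row, column, symbol) in which each of the three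
  pairs of coordinates runs exactly once through the diagram. Merge rows, columns and symbols into
  three classes of sizes \<open>x\<close>, \<open>y\<close>, \<open>z\<close>. The two inequalities say precisely that there are
  nonnegative multiplicities for the triples of classes with the correct pair counts. Such an
  outline can always be split back into individual symbols, rows and columns, as for outline Latin
  squares, using balanced edge colourings of bipartite multigraphs, which come from Hall's theorem.
\<close>

section \<open>Balanced edge colourings of bipartite multigraphs\<close>

text \<open>Induction on the number of sets, split by whether some proper nonempty subfamily is
  tight, that is, has a union no larger than itself.\<close>

theorem hall_marriage:
  assumes "finite I" and "\<And>i. i \<in> I \<Longrightarrow> finite (A i)"
    and "\<And>J. J \<subseteq> I \<Longrightarrow> card J \<le> card (\<Union>i\<in>J. A i)"
  shows "\<exists>R. inj_on R I \<and> (\<forall>i\<in>I. R i \<in> A i)"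
  using assms
proof (induction "card I" arbitrary: I A rule: less_induct)
  case less
  note fin = less.prems(1) and finA = less.prems(2) and hall = less.prems(3)
  show ?case
  proof (cases "I = {}")
    case True
    then show ?thesis by simp
  next
    case False
    then obtain i where i: "i \<in> I" by blast
    show ?thesis
    proof (cases "\<forall>J. J \<subseteq> I \<longrightarrow> J \<noteq> {} \<longrightarrow> J \<noteq> I \<longrightarrow> card J < card (\<Union>j\<in>J. A j)")
      \<comment> \<open>Every proper nonempty subfamily has a spare element, so removing an
        arbitrary \<open>a\<close> chosen for \<open>i\<close> preserves Hall's condition for the
        rest.\<close>
      case True
      have "card {i} \<le> card (A i)" using hall[of "{i}"] i by simp
      then obtain a where a: "a \<in> A i" by fastforce
      have "\<exists>R. inj_on R (I - {i}) \<and> (\<forall>j\<in>I - {i}. R j \<in> A j - {a})"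
      proof (rule less.hyps)
        show "card (I - {i}) < card I" using fin i by (rule card_Diff1_less)
        show "finite (I - {i})" using fin by simp
        show "finite (A j - {a})" if "j \<in> I - {i}" for j using that finA by simp
        show "card J \<le> card (\<Union>j\<in>J. A j - {a})" if J: "J \<subseteq> I - {i}" for J
        proof (cases "J = {}")
          case False
          have "J \<subseteq> I" "J \<noteq> I" using J i by auto
          then have "card J < card (\<Union>j\<in>J. A j)" using True False by blast
          moreover have "finite (\<Union>j\<in>J. A j)"
            using \<open>J \<subseteq> I\<close> fin finA by (meson finite_UN_I finite_subset subsetD)
          then have "card (\<Union>j\<in>J. A j) \<le> Suc (card ((\<Union>j\<in>J. A j) - {a}))"
            by (auto simp: card_Diff_singleton_if)
          ultimately have "card J \<le> card ((\<Union>j\<in>J. A j) - {a})" by linarith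
          also have "(\<Union>j\<in>J. A j) - {a} = (\<Union>j\<in>J. A j - {a})" by auto
          finally show ?thesis .
        qed simp
      qed
      then obtain R where R: "inj_on R (I - {i})" "\<And>j. j \<in> I - {i} \<Longrightarrow> R j \<in> A j - {a}"
        by blast
      have "inj_on (R(i := a)) I"
        using R unfolding inj_on_def by (auto split: if_splits)
      moreover have "\<forall>j\<in>I. (R(i := a)) j \<in> A j" using R a by auto
      ultimately show ?thesis by blast
    next
      case False
      then obtain J where J: "J \<subseteq> I" "J \<noteq> {}" "J \<noteq> I" "card (\<Union>j\<in>J. A j) \<le> card J"
        by (metis not_le)
      define U where "U = (\<Union>j\<in>J. A j)"
      have finJ: "finite J" using J fin finite_subset by blast
      have finU: "finite U" unfolding U_def using J finJ finA by blast
      have "\<exists>R. inj_on R J \<and> (\<forall>j\<in>J. R j \<in> A j)"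
      proof (rule less.hyps)
        show "card J < card I" using J fin by (simp add: psubset_card_mono psubsetI)
        show "card K \<le> card (\<Union>j\<in>K. A j)" if "K \<subseteq> J" for K
          using that J hall by blast
      qed (use J finJ finA in auto)
      then obtain R where R: "inj_on R J" "\<And>j. j \<in> J \<Longrightarrow> R j \<in> A j" by blast
      have "\<exists>R. inj_on R (I - J) \<and> (\<forall>j\<in>I - J. R j \<in> A j - U)"
      proof (rule less.hyps)
        show "card (I - J) < card I" using J fin
          by (intro psubset_card_mono) auto
        show "finite (I - J)" using fin by simp
        show "finite (A j - U)" if "j \<in> I - J" for j using that finA by simp
        show "card K \<le> card (\<Union>j\<in>K. A j - U)" if K: "K \<subseteq> I - J" for K
        proof -
          have finK: "finite K" using K fin finite_subset by blast
          \<comment> \<open>Hall's condition for \<open>K\<close> outside \<open>U\<close> comes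
            from the condition for \<open>K \<union> J\<close>: since \<open>J\<close> is tight,
            \<open>U\<close> accounts for at most \<open>card J\<close> of the union.\<close>
          have "card K + card J = card (K \<union> J)"
            using K finK finJ by (subst card_Un_disjoint) auto
          also have "\<dots> \<le> card (\<Union>j\<in>K \<union> J. A j)" using K J by (intro hall) auto
          also have "(\<Union>j\<in>K \<union> J. A j) = (\<Union>j\<in>K. A j - U) \<union> U" unfolding U_def by auto
          also have "card \<dots> \<le> card (\<Union>j\<in>K. A j - U) + card U" by (rule card_Un_le)
          finally show ?thesis using J(4) unfolding U_def by linarith
        qed
      qed
      then obtain S where S: "inj_on S (I - J)" "\<And>j. j \<in> I - J \<Longrightarrow> S j \<in> A j - U" by blast
      define Q where "Q j = (if j \<in> J then R j else S j)" for j
      have "R j \<noteq> S l" if "j \<in> J" "l \<in> I - J" for j l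
        using R(2)[OF that(1)] S(2)[OF that(2)] that(1) unfolding U_def by auto
      then have "inj_on Q I"
        using R(1) S(1) unfolding inj_on_def Q_def by (metis DiffI)
      moreover have "\<forall>j\<in>I. Q j \<in> A j" unfolding Q_def using R S by auto
      ultimately show ?thesis by blast
    qed
  qed
qed

section \<open>Matchings and factors of bipartite multigraphs\<close>

lemma card_fibres_uniform:
  assumes "finite E" and "\<And>v. v \<in> J \<Longrightarrow> card {e \<in> E. f e = v} = k" and "finite J"
  shows "card {e \<in> E. f e \<in> J} = k * card J"
proof -
  have "{e \<in> E. f e \<in> J} = (\<Union>v\<in>J. {e \<in> E. f e = v})" by auto
  also have "card \<dots> = (\<Sum>v\<in>J. card {e \<in> E. f e = v})"
    using assms by (intro card_UN_disjoint) auto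
  finally show ?thesis using assms by simp
qed

text \<open>\<open>E\<close> is an abstract set of edges with end points given by \<open>f\<close>
  and \<open>g\<close>, so parallel edges are allowed. Counting the edges at a set of
  \<open>f\<close>-vertices and at its neighbours gives Hall's condition.\<close>

lemma regular_bipartite_perfect_matching:
  assumes fin: "finite E" and k: "k > 0"
    and f: "\<And>e. e \<in> E \<Longrightarrow> card {x \<in> E. f x = f e} = k"
    and g: "\<And>e. e \<in> E \<Longrightarrow> card {x \<in> E. g x = g e} = k"
  obtains F where "F \<subseteq> E" "inj_on f F" "f ` F = f ` E" "inj_on g F" "g ` F = g ` E"
proof -
  define A where "A v = g ` {e \<in> E. f e = v}" for v
  have f': "card {e \<in> E. f e \<in> J} = k * card J" if "J \<subseteq> f ` E" for J
    using that f fin by (intro card_fibres_uniform) (auto intro: finite_subset)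
  have g': "card {e \<in> E. g e \<in> J} = k * card J" if "J \<subseteq> g ` E" for J
    using that g fin by (intro card_fibres_uniform) (auto intro: finite_subset)
  have "\<exists>R. inj_on R (f ` E) \<and> (\<forall>i\<in>f ` E. R i \<in> A i)"
  proof (rule hall_marriage)
    show "card J \<le> card (\<Union>i\<in>J. A i)" if J: "J \<subseteq> f ` E" for J
    proof -
      have "k * card J = card {e \<in> E. f e \<in> J}" using f' J by simp
      also have "\<dots> \<le> card {e \<in> E. g e \<in> (\<Union>i\<in>J. A i)}"
        using fin by (intro card_mono) (auto simp: A_def)
      also have "\<dots> = k * card (\<Union>i\<in>J. A i)" by (rule g') (auto simp: A_def)
      finally show ?thesis using k by simp
    qed
  qed (use fin in \<open>auto simp: A_def\<close>)
  then obtain R where R: "inj_on R (f ` E)" "\<forall>v\<in>f ` E. R v \<in> A v" by blast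
  have "\<forall>v\<in>f ` E. \<exists>e. e \<in> E \<and> f e = v \<and> g e = R v"
  proof
    fix v assume "v \<in> f ` E"
    then have "R v \<in> g ` {e \<in> E. f e = v}" using R(2) unfolding A_def by (rule bspec[rotated])
    then show "\<exists>e. e \<in> E \<and> f e = v \<and> g e = R v" by force
  qed
  from bchoice[OF this]
  obtain h where h: "\<And>v. v \<in> f ` E \<Longrightarrow> h v \<in> E \<and> f (h v) = v \<and> g (h v) = R v" by auto
  define F where "F = h ` f ` E"
  have sub: "F \<subseteq> E" unfolding F_def using h by blast
  have injf: "inj_on f F" unfolding F_def inj_on_def using h by auto
  have imf: "f ` F = f ` E" unfolding F_def using h by (force simp: image_iff)
  have injg: "inj_on g F" unfolding F_def inj_on_def using h R(1) by (auto dest: inj_onD)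
  \<comment> \<open>Both sides count all edges, so the two vertex sets have equal size and the
    matching covers the \<open>g\<close>-side as well.\<close>
  have "k * card (f ` E) = k * card (g ` E)"
  proof -
    have "{e \<in> E. f e \<in> f ` E} = E" "{e \<in> E. g e \<in> g ` E} = E" by auto
    then show ?thesis using f'[of "f ` E"] g'[of "g ` E"] by simp
  qed
  then have "card (g ` F) = card (g ` E)"
    using k imf card_image[OF injf] card_image[OF injg] by simp
  then have "g ` F = g ` E" using sub fin by (intro card_subset_eq) auto
  then show ?thesis using that sub injf imf injg by blast
qed

text \<open>Number the elements from 0 and cut the numbering into consecutive blocks of length
  \<open>k\<close>.\<close>

lemma split_fibre:
  assumes "finite A" and "card A = k * (d :: nat)"
  obtains p :: "'a \<Rightarrow> nat" where "p ` A \<subseteq> {..<d}" "\<And>i. i < d \<Longrightarrow> card {a \<in> A. p a = i} = k"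
proof (cases "k = 0")
  case True
  then have "A = {}" using assms by simp
  then show ?thesis using that[of "\<lambda>_. 0"] True by simp
next
  case False
  obtain h where h: "bij_betw h A {0..<card A}" using ex_bij_betw_finite_nat[OF assms(1)] by blast
  have "card {a \<in> A. h a div k = i} = k" if "i < d" for i
  proof -
    have "h ` {a \<in> A. h a div k = i} = {m \<in> h ` A. m div k = i}" by auto
    also have "\<dots> = {i * k..<i * k + k}"
    proof -
      have "m < k * d" if "m < i * k + k" for m
      proof -
        have "(Suc i) * k \<le> d * k" using \<open>i < d\<close> by (intro mult_le_mono1) simp
        then show ?thesis using that by (simp add: mult.commute add.commute)
      qed
      moreover have "m div k = i \<longleftrightarrow> i * k \<le> m \<and> m < i * k + k" for m
        using False dividend_less_div_times[of k m]
        by (auto simp: mult.commute add.commute intro: div_nat_eqI)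
      ultimately show ?thesis using h assms(2) by (auto simp: bij_betw_def)
    qed
    finally have "card (h ` {a \<in> A. h a div k = i}) = k" by simp
    moreover have "inj_on h {a \<in> A. h a div k = i}"
      using h by (auto simp: bij_betw_def inj_on_def)
    ultimately show ?thesis by (simp add: card_image)
  qed
  moreover have "(\<lambda>a. h a div k) ` A \<subseteq> {..<d}"
  proof (rule image_subsetI)
    fix a assume "a \<in> A"
    then have "h a < d * k" using h assms(2) by (auto simp: bij_betw_def mult.commute)
    then show "h a div k \<in> {..<d}" by (simp add: less_mult_imp_div_less)
  qed
  ultimately show ?thesis using that by blast
qed

text \<open>Reduction to regular graphs: a vertex \<open>v\<close> of degree \<open>k * d v\<close>
  becomes \<open>d v\<close> copies \<open>(v, i)\<close> of degree \<open>k\<close>, and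
  \<open>p\<close> names the copy that an edge moves to.\<close>

lemma split_vertices:
  assumes fin: "finite E" and deg: "\<And>v. card {e \<in> E. f e = v} = k * (d v :: nat)"
  obtains p :: "'e \<Rightarrow> nat" where
    "\<And>e. e \<in> E \<Longrightarrow> p e < d (f e)"
    "\<And>v i. i < d v \<Longrightarrow> card {e \<in> E. (f e, p e) = (v, i)} = k"
proof -
  have "\<exists>p. p ` {e \<in> E. f e = v} \<subseteq> {..<d v} \<and>
      (\<forall>i<d v. card {a \<in> {e \<in> E. f e = v}. p a = i} = k)" for v
  proof -
    have "finite {e \<in> E. f e = v}" using fin by simp
    from split_fibre[OF this deg] show ?thesis by blast
  qed
  then have "\<forall>v. \<exists>p. p ` {e \<in> E. f e = v} \<subseteq> {..<d v} \<and>
      (\<forall>i<d v. card {a \<in> {e \<in> E. f e = v}. p a = i} = k)" ..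
  from choice[OF this] obtain p where
    "\<forall>v. p v ` {e \<in> E. f e = v} \<subseteq> {..<d v} \<and>
      (\<forall>i<d v. card {a \<in> {e \<in> E. f e = v}. p v a = i} = k)" ..
  then have p: "\<And>v. p v ` {e \<in> E. f e = v} \<subseteq> {..<d v}"
    "\<And>v i. i < d v \<Longrightarrow> card {a \<in> {e \<in> E. f e = v}. p v a = i} = k"
    by simp_all
  show ?thesis
  proof (rule that[of "\<lambda>e. p (f e) e"])
    show "p (f e) e < d (f e)" if "e \<in> E" for e using p(1)[of "f e"] that by auto
    show "card {e \<in> E. (f e, p (f e) e) = (v, i)} = k" if "i < d v" for v i
    proof -
      have "{e \<in> E. (f e, p (f e) e) = (v, i)} = {a \<in> {e \<in> E. f e = v}. p v a = i}" by auto
      then show ?thesis using p(2) that by simp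
    qed
  qed
qed

text \<open>Undoes the splitting: merging the copies again leaves \<open>v\<close> one matching edge
  from each of its \<open>d v\<close> copies.\<close>

lemma card_fibre_transversal:
  assumes p: "\<And>e. e \<in> E \<Longrightarrow> p e < d (f e)"
    and fibre: "\<And>v i. i < d v \<Longrightarrow> card {e \<in> E. (f e, p e) = (v, i)} = k" and k: "k > 0"
    and F: "F \<subseteq> E" "inj_on (\<lambda>e. (f e, p e)) F" "(\<lambda>e. (f e, p e)) ` F = (\<lambda>e. (f e, p e)) ` E"
  shows "card {e \<in> F. f e = v} = d v"
proof -
  have "(v, i) \<in> (\<lambda>e. (f e, p e)) ` F" if i: "i < d v" for i
  proof -
    have "{e \<in> E. (f e, p e) = (v, i)} \<noteq> {}" using fibre[OF i] k by (metis card.empty less_irrefl)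
    then have "(v, i) \<in> (\<lambda>e. (f e, p e)) ` E" by (auto simp: image_iff)
    then show ?thesis using F(3) by simp
  qed
  then have "{..<d v} \<subseteq> p ` {e \<in> F. f e = v}" by force
  then have "bij_betw p {e \<in> F. f e = v} {..<d v}"
    using F p unfolding bij_betw_def inj_on_def by auto
  then show ?thesis by (simp add: bij_betw_same_card)
qed

text \<open>Split the vertices on both sides to get a \<open>k\<close>-regular graph, take a perfect
  matching and merge the copies.\<close>

lemma bipartite_factor:
  assumes fin: "finite E" and k: "k > 0"
    and f: "\<And>v. card {e \<in> E. f e = v} = k * df v"
    and g: "\<And>w. card {e \<in> E. g e = w} = k * dg w"
  obtains F where "F \<subseteq> E" "\<And>v. card {e \<in> F. f e = v} = df v" "\<And>w. card {e \<in> F. g e = w} = dg w"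
proof -
  obtain p where p: "\<And>e. e \<in> E \<Longrightarrow> p e < df (f e)"
    "\<And>v i. i < df v \<Longrightarrow> card {e \<in> E. (f e, p e) = (v, i)} = k"
    using split_vertices[OF fin f] by blast
  obtain q where q: "\<And>e. e \<in> E \<Longrightarrow> q e < dg (g e)"
    "\<And>v i. i < dg v \<Longrightarrow> card {e \<in> E. (g e, q e) = (v, i)} = k"
    using split_vertices[OF fin g] by blast
  obtain F where F: "F \<subseteq> E" "inj_on (\<lambda>e. (f e, p e)) F"
    "(\<lambda>e. (f e, p e)) ` F = (\<lambda>e. (f e, p e)) ` E" "inj_on (\<lambda>e. (g e, q e)) F"
    "(\<lambda>e. (g e, q e)) ` F = (\<lambda>e. (g e, q e)) ` E"
    by (rule regular_bipartite_perfect_matching[of E k "\<lambda>e. (f e, p e)" "\<lambda>e. (g e, q e)",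
          OF fin k p(2)[OF p(1)] q(2)[OF q(1)]])
  show ?thesis
    using that[OF F(1) card_fibre_transversal[OF p k F(1-3)]
        card_fibre_transversal[OF q k F(1,4,5)]] by blast
qed

text \<open>Each induction step peels off a factor as one colour class, which leaves degrees
  \<open>k * df v\<close> and \<open>k * dg w\<close> for the remaining \<open>k\<close>
  colours.\<close>

lemma balanced_edge_colouring:
  assumes "finite E" and "\<And>v. card {e \<in> E. f e = v} = k * df v"
    and "\<And>w. card {e \<in> E. g e = w} = k * dg w"
  shows "\<exists>col. (\<forall>e\<in>E. col e < k) \<and> (\<forall>i<k. \<forall>v. card {e \<in> E. f e = v \<and> col e = i} = df v) \<and>
    (\<forall>i<k. \<forall>w. card {e \<in> E. g e = w \<and> col e = i} = dg w)"
  using assms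
proof (induction k arbitrary: E)
  case 0
  have "e \<notin> E" for e
    using 0(2)[of "f e"] 0(1) by auto
  then show ?case by auto
next
  case (Suc k)
  obtain F where F: "F \<subseteq> E" "\<And>v. card {e \<in> F. f e = v} = df v" "\<And>w. card {e \<in> F. g e = w} = dg w"
    using bipartite_factor[OF Suc.prems(1) _ Suc.prems(2,3)] by blast
  have finF: "finite F" using F(1) Suc.prems(1) finite_subset by blast
  have diff: "card {e \<in> E - F. h e = v} = card {e \<in> E. h e = v} - card {e \<in> F. h e = v}"
    for h :: "_ \<Rightarrow> 'z" and v
  proof -
    have "{e \<in> E - F. h e = v} = {e \<in> E. h e = v} - {e \<in> F. h e = v}" by auto
    then show ?thesis using F(1) finF by (simp add: card_Diff_subset Collect_mono_iff subset_iff)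
  qed
  have "\<exists>col. (\<forall>e\<in>E - F. col e < k) \<and>
      (\<forall>i<k. \<forall>v. card {e \<in> E - F. f e = v \<and> col e = i} = df v) \<and>
      (\<forall>i<k. \<forall>w. card {e \<in> E - F. g e = w \<and> col e = i} = dg w)"
  proof (rule Suc.IH)
    show "card {e \<in> E - F. f e = v} = k * df v" for v
      unfolding diff Suc.prems(2) F(2) by simp
    show "card {e \<in> E - F. g e = w} = k * dg w" for w
      unfolding diff Suc.prems(3) F(3) by simp
  qed (use Suc.prems(1) in simp)
  then obtain col where col: "\<And>e. e \<in> E - F \<Longrightarrow> col e < k"
    "\<And>i v. i < k \<Longrightarrow> card {e \<in> E - F. f e = v \<and> col e = i} = df v"
    "\<And>i w. i < k \<Longrightarrow> card {e \<in> E - F. g e = w \<and> col e = i} = dg w"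
    by blast
  define col' where "col' e = (if e \<in> F then k else col e)" for e
  have new: "{e \<in> E. h e = v \<and> col' e = i} = (if i = k then {e \<in> F. h e = v}
      else {e \<in> E - F. h e = v \<and> col e = i})" if "i < Suc k" for h :: "_ \<Rightarrow> 'z" and v i
    using F(1) col(1) that unfolding col'_def by (auto split: if_splits)
  show ?case
  proof (intro exI[of _ col'] conjI ballI allI impI)
    show "col' e < Suc k" if "e \<in> E" for e
      using that col(1)[of e] unfolding col'_def by (auto simp: less_Suc_eq)
    show "card {e \<in> E. f e = v \<and> col' e = i} = df v" if "i < Suc k" for i v
      using that F(2)[of v] col(2)[of i v] by (cases "i = k") (simp_all only: new if_True if_False, simp)
    show "card {e \<in> E. g e = w \<and> col' e = i} = dg w" if "i < Suc k" for i w
      using that F(3)[of w] col(3)[of i w] by (cases "i = k") (simp_all only: new if_True if_False, simp)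
  qed
qed

section \<open>Splitting classes of triples\<close>

text \<open>For each class \<open>a\<close>, the elements with \<open>h e = a\<close> are the edges
  of a bipartite graph between \<open>f\<close>-values and \<open>g\<close>-values. A colouring with
  \<open>w a\<close> colours assigns them to the individuals \<open>(a, i)\<close> of the
  class.\<close>

lemma detach_class:
  fixes w :: "'c \<Rightarrow> nat"
  assumes fin: "finite E"
    and f: "\<And>v a. card {e \<in> E. f e = v \<and> h e = a} = w a * df v a"
    and g: "\<And>v a. card {e \<in> E. g e = v \<and> h e = a} = w a * dg v a"
  obtains p :: "'e \<Rightarrow> nat" where "\<And>e. e \<in> E \<Longrightarrow> p e < w (h e)"
    "\<And>v a i. i < w a \<Longrightarrow> card {e \<in> E. f e = v \<and> (h e, p e) = (a, i)} = df v a"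
    "\<And>v a i. i < w a \<Longrightarrow> card {e \<in> E. g e = v \<and> (h e, p e) = (a, i)} = dg v a"
proof -
  define H where "H a = {e \<in> E. h e = a}" for a
  have "\<exists>col. (\<forall>e\<in>H a. col e < w a) \<and>
      (\<forall>i<w a. \<forall>v. card {e \<in> H a. f e = v \<and> col e = i} = df v a) \<and>
      (\<forall>i<w a. \<forall>v. card {e \<in> H a. g e = v \<and> col e = i} = dg v a)" for a
  proof (rule balanced_edge_colouring)
    show "finite (H a)" using fin by (simp add: H_def)
    have "{e \<in> H a. f e = v} = {e \<in> E. f e = v \<and> h e = a}" for v by (auto simp: H_def)
    then show "card {e \<in> H a. f e = v} = w a * df v a" for v using f by simp
    have "{e \<in> H a. g e = v} = {e \<in> E. g e = v \<and> h e = a}" for v by (auto simp: H_def)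
    then show "card {e \<in> H a. g e = v} = w a * dg v a" for v using g by simp
  qed
  then have "\<forall>a. \<exists>col. (\<forall>e\<in>H a. col e < w a) \<and>
      (\<forall>i<w a. \<forall>v. card {e \<in> H a. f e = v \<and> col e = i} = df v a) \<and>
      (\<forall>i<w a. \<forall>v. card {e \<in> H a. g e = v \<and> col e = i} = dg v a)" ..
  from choice[OF this] obtain col where "\<forall>a. (\<forall>e\<in>H a. col a e < w a) \<and>
      (\<forall>i<w a. \<forall>v. card {e \<in> H a. f e = v \<and> col a e = i} = df v a) \<and>
      (\<forall>i<w a. \<forall>v. card {e \<in> H a. g e = v \<and> col a e = i} = dg v a)" ..
  then have col: "\<And>a e. e \<in> H a \<Longrightarrow> col a e < w a"
      "\<And>a i v. i < w a \<Longrightarrow> card {e \<in> H a. f e = v \<and> col a e = i} = df v a"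
      "\<And>a i v. i < w a \<Longrightarrow> card {e \<in> H a. g e = v \<and> col a e = i} = dg v a" by simp_all
  show ?thesis
  proof (rule that[of "\<lambda>e. col (h e) e"])
    show "col (h e) e < w (h e)" if "e \<in> E" for e using col(1)[of e "h e"] that by (simp add: H_def)
    fix v a i assume i: "i < w a"
    have "{e \<in> E. f e = v \<and> (h e, col (h e) e) = (a, i)} = {e \<in> H a. f e = v \<and> col a e = i}"
      for v by (auto simp: H_def)
    then show "card {e \<in> E. f e = v \<and> (h e, col (h e) e) = (a, i)} = df v a" for v
      using col(2)[OF i] by simp
    have "{e \<in> E. g e = v \<and> (h e, col (h e) e) = (a, i)} = {e \<in> H a. g e = v \<and> col a e = i}"
      for v by (auto simp: H_def)
    then show "card {e \<in> E. g e = v \<and> (h e, col (h e) e) = (a, i)} = dg v a" for v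
      using col(3)[OF i] by simp
  qed
qed

text \<open>Each class \<open>a\<close> of rows, of columns or of symbols stands for \<open>w a\<close> individuals, and \<open>R\<close>, \<open>C\<close>, \<open>S\<close>
  give the classes of the triple \<open>e\<close>. Splitting one kind of class is a balanced edge colouring of
  the bipartite graph formed by the other two kinds; the degrees left behind are again divisible by
  the sizes of the classes still to be split.\<close>

lemma outline_detachment:
  fixes w :: "'c \<Rightarrow> nat" and l :: "'c \<Rightarrow> 'c \<Rightarrow> nat"
  assumes fin: "finite E"
    and RC: "\<And>a b. card {e \<in> E. R e = a \<and> C e = b} = w a * w b * l a b"
    and RS: "\<And>a b. card {e \<in> E. R e = a \<and> S e = b} = w a * w b * l a b"
    and CS: "\<And>a b. card {e \<in> E. C e = a \<and> S e = b} = w a * w b * l a b"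
  obtains r c s :: "'e \<Rightarrow> nat" where
    "\<And>e. e \<in> E \<Longrightarrow> r e < w (R e)" "\<And>e. e \<in> E \<Longrightarrow> c e < w (C e)" "\<And>e. e \<in> E \<Longrightarrow> s e < w (S e)"
    "\<And>a b i j. i < w a \<Longrightarrow> j < w b \<Longrightarrow>
      card {e \<in> E. (R e, r e) = (a, i) \<and> (C e, c e) = (b, j)} = l a b"
    "\<And>a b i j. i < w a \<Longrightarrow> j < w b \<Longrightarrow>
      card {e \<in> E. (R e, r e) = (a, i) \<and> (S e, s e) = (b, j)} = l a b"
    "\<And>a b i j. i < w a \<Longrightarrow> j < w b \<Longrightarrow>
      card {e \<in> E. (C e, c e) = (a, i) \<and> (S e, s e) = (b, j)} = l a b"
proof -
  \<comment> \<open>The size of the class being split, here the symbol class \<open>b\<close>, has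
    to be the leading factor; the factor \<open>w a\<close> left over is what allows rows and
    columns to be split later.\<close>
  have RS': "card {e \<in> E. R e = a \<and> S e = b} = w b * (w a * l a b)" for a b
    using RS by (simp add: ac_simps)
  have CS': "card {e \<in> E. C e = a \<and> S e = b} = w b * (w a * l a b)" for a b
    using CS by (simp add: ac_simps)
  obtain s where s: "\<And>e. e \<in> E \<Longrightarrow> s e < w (S e)"
    "\<And>v a i. i < w a \<Longrightarrow> card {e \<in> E. R e = v \<and> (S e, s e) = (a, i)} = w v * l v a"
    "\<And>v a i. i < w a \<Longrightarrow> card {e \<in> E. C e = v \<and> (S e, s e) = (a, i)} = w v * l v a"
    by (rule detach_class[OF fin RS' CS']) blast
  \<comment> \<open>The count of an individual symbol \<open>v\<close> against one individual row or
    column of class \<open>a\<close>. The value 0 covers indices beyond the class size, which no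
    triple uses but for which \<open>detach_class\<close> also asks a count.\<close>
  define L where "L v a = (if snd v < w (fst v) then l a (fst v) else 0)" for v :: "'c \<times> nat" and a
  have SR: "card {e \<in> E. (S e, s e) = v \<and> R e = a} = w a * L v a" for v a
  proof (cases "snd v < w (fst v)")
    case True
    moreover have "{e \<in> E. (S e, s e) = v \<and> R e = a} =
        {e \<in> E. R e = a \<and> (S e, s e) = (fst v, snd v)}" by auto
    ultimately show ?thesis using s(2)[OF True] by (simp add: L_def)
  next
    case False
    have "{e \<in> E. (S e, s e) = v \<and> R e = a} = {}"
    proof (rule equals0I)
      fix e assume "e \<in> {e \<in> E. (S e, s e) = v \<and> R e = a}"
      then show False using False s(1)[of e] by auto
    qed
    then show ?thesis using False by (simp only: card.empty L_def if_False mult_0_right)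
  qed
  have SC: "card {e \<in> E. (S e, s e) = v \<and> C e = a} = w a * L v a" for v a
  proof (cases "snd v < w (fst v)")
    case True
    moreover have "{e \<in> E. (S e, s e) = v \<and> C e = a} =
        {e \<in> E. C e = a \<and> (S e, s e) = (fst v, snd v)}" by auto
    ultimately show ?thesis using s(3)[OF True] by (simp add: L_def)
  next
    case False
    have "{e \<in> E. (S e, s e) = v \<and> C e = a} = {}"
    proof (rule equals0I)
      fix e assume "e \<in> {e \<in> E. (S e, s e) = v \<and> C e = a}"
      then show False using False s(1)[of e] by auto
    qed
    then show ?thesis using False by (simp only: card.empty L_def if_False mult_0_right)
  qed
  have CR: "card {e \<in> E. C e = v \<and> R e = a} = w a * (w v * l a v)" for v a
    using RC[of a v] by (simp add: ac_simps conj_commute)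
  obtain r where r: "\<And>e. e \<in> E \<Longrightarrow> r e < w (R e)"
    "\<And>v a i. i < w a \<Longrightarrow> card {e \<in> E. (S e, s e) = v \<and> (R e, r e) = (a, i)} = L v a"
    "\<And>v a i. i < w a \<Longrightarrow> card {e \<in> E. C e = v \<and> (R e, r e) = (a, i)} = w v * l a v"
    by (rule detach_class[OF fin SR CR]) blast
  define K where "K v a = (if snd v < w (fst v) then l (fst v) a else 0)" for v :: "'c \<times> nat" and a
  have RC': "card {e \<in> E. (R e, r e) = v \<and> C e = a} = w a * K v a" for v a
  proof (cases "snd v < w (fst v)")
    case True
    moreover have "{e \<in> E. (R e, r e) = v \<and> C e = a} =
        {e \<in> E. C e = a \<and> (R e, r e) = (fst v, snd v)}" by auto
    ultimately show ?thesis using r(3)[OF True] by (simp add: K_def)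
  next
    case False
    have "{e \<in> E. (R e, r e) = v \<and> C e = a} = {}"
    proof (rule equals0I)
      fix e assume "e \<in> {e \<in> E. (R e, r e) = v \<and> C e = a}"
      then show False using False r(1)[of e] by auto
    qed
    then show ?thesis using False by (simp only: card.empty K_def if_False mult_0_right)
  qed
  \<comment> \<open>\<open>SC\<close> is still available after the row split, as it involves only
    columns and symbols.\<close>
  obtain c where c: "\<And>e. e \<in> E \<Longrightarrow> c e < w (C e)"
    "\<And>v a i. i < w a \<Longrightarrow> card {e \<in> E. (R e, r e) = v \<and> (C e, c e) = (a, i)} = K v a"
    "\<And>v a i. i < w a \<Longrightarrow> card {e \<in> E. (S e, s e) = v \<and> (C e, c e) = (a, i)} = L v a"
    by (rule detach_class[OF fin RC' SC]) blast
  show ?thesis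
  proof (rule that[OF r(1) c(1) s(1)])
    fix a b i j assume ij: "i < w a" "j < w b"
    show "card {e \<in> E. (R e, r e) = (a, i) \<and> (C e, c e) = (b, j)} = l a b"
      using c(2)[OF ij(2), of "(a, i)"] ij by (simp add: K_def)
    have "{e \<in> E. (R e, r e) = (a, i) \<and> (S e, s e) = (b, j)} =
        {e \<in> E. (S e, s e) = (b, j) \<and> (R e, r e) = (a, i)}" by auto
    then show "card {e \<in> E. (R e, r e) = (a, i) \<and> (S e, s e) = (b, j)} = l a b"
      using r(2)[OF ij(1), of "(b, j)"] ij by (simp add: L_def)
    have "{e \<in> E. (C e, c e) = (a, i) \<and> (S e, s e) = (b, j)} =
        {e \<in> E. (S e, s e) = (b, j) \<and> (C e, c e) = (a, i)}" by auto
    then show "card {e \<in> E. (C e, c e) = (a, i) \<and> (S e, s e) = (b, j)} = l a b"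
      using c(3)[OF ij(1), of "(b, j)"] ij by (simp add: L_def)
  qed
qed

section \<open>Latin tableaux as sets of triples\<close>

lemma part_antimono:
  assumes "is_partition la" "i \<le> j"
  shows "part la j \<le> part la i"
  using assms sorted_wrt_nth_less[of "(\<ge>)" la i j]
  by (cases "i = j") (auto simp: is_partition_def part_def)

lemma part_pos_iff:
  assumes "is_partition la"
  shows "0 < part la r \<longleftrightarrow> r < length la"
  using assms by (auto simp: is_partition_def part_def)

lemma part_conjugate:
  assumes "is_partition la"
  shows "part (conjugate la) c = card {r. c < part la r}"
proof (cases "c < part la 0")
  case True
  then show ?thesis by (simp add: conjugate_def part_def[of "map _ _"])
next
  case False
  then have "{r. c < part la r} = {}"
    using part_antimono[OF assms, of 0] by (auto simp: not_less intro: order_trans)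
  then show ?thesis using False by (simp add: conjugate_def part_def[of "map _ _"])
qed

text \<open>A finite down-closed set of naturals is an initial segment, fixed by its
  cardinality.\<close>

lemma row_set_eq:
  assumes "is_partition la"
  shows "{r. c < part la r} = {..<part (conjugate la) c}"
proof -
  define D where "D = {r. c < part la r}"
  have "D \<subseteq> {..<length la}" by (auto simp: D_def part_def split: if_splits)
  then have fin: "finite D" using finite_subset by blast
  have down: "r' \<in> D" if "r \<in> D" "r' \<le> r" for r r'
    using that part_antimono[OF assms that(2)] by (auto simp: D_def)
  have "D = {..<card D}"
  proof (cases "D = {}")
    case False
    have "D = {..Max D}" using down[OF Max_in[OF fin False]] Max_ge[OF fin] by auto
    then show ?thesis by (metis card_atMost lessThan_Suc_atMost)
  qed simp
  then show ?thesis using part_conjugate[OF assms] by (simp add: D_def)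
qed

text \<open>\<open>RC\<close> puts exactly one triple on each cell and none outside; its symbol
  gives the entry. At most one triple per row and symbol, or column and symbol, is the distinctness
  condition, and the exact count \<open>RS\<close> gives the frequencies.\<close>

lemma latin_from_triples:
  assumes la: "is_partition la"
    and RC: "\<And>i j. card {e \<in> E. R e = i \<and> C e = j} = of_bool (j < part la i)"
    and RS: "\<And>i j. card {e \<in> E. R e = i \<and> S e = j} = of_bool (j < part la i)"
    and CS: "\<And>i j. card {e \<in> E. C e = i \<and> S e = j} = of_bool (j < part la i)"
    and fin: "finite E"
  shows "latin la"
proof -
  have uniq: "e = e'" if "card {e \<in> E. P e} = of_bool b" "e \<in> E" "e' \<in> E" "P e" "P e'" for P b e e'
  proof -
    have "card {e \<in> E. P e} \<le> Suc 0" using that(1) by simp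
    then show ?thesis using that fin card_le_Suc0_iff_eq[of "{e \<in> E. P e}"] by auto
  qed
  have mem: "j < part la i" if "card {e \<in> E. P e} = of_bool (j < part la i)" "e \<in> E" "P e" for P e i j
    using that fin by (cases "j < part la i") auto
  have RSinj: "e = e'" if "e \<in> E" "e' \<in> E" "R e = R e'" "S e = S e'" for e e'
    by (rule uniq[OF RS[of "R e'" "S e'"]]) (use that in simp_all)
  have CSinj: "e = e'" if "e \<in> E" "e' \<in> E" "C e = C e'" "S e = S e'" for e e'
    by (rule uniq[OF CS[of "C e'" "S e'"]]) (use that in simp_all)
  have diag: "(i, j) \<in> young_diagram la \<longleftrightarrow> j < part la i" for i j
    using part_pos_iff[OF la, of i] by (auto simp: young_diagram_def)
  define G where "G x = (THE e. e \<in> E \<and> R e = fst x \<and> C e = snd x)" for x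
  have G: "G (R e, C e) = e" if "e \<in> E" for e
    unfolding G_def using that uniq[OF RC[of "R e" "C e"]] by (intro the_equality) auto
  have cell: "\<exists>e\<in>E. x = (R e, C e)" if "x \<in> young_diagram la" for x
  proof -
    have "card {e \<in> E. R e = fst x \<and> C e = snd x} = 1" using that RC diag by (cases x) simp
    then have "{e \<in> E. R e = fst x \<and> C e = snd x} \<noteq> {}" by force
    then show ?thesis by (auto intro!: bexI prod_eqI)
  qed
  \<comment> \<open>Symbols count from 0 while entries must be positive; the shift matches
    \<open>part (conjugate la) (i - 1)\<close>.\<close>
  define T where "T x = Suc (S (G x))" for x
  show ?thesis unfolding latin_def
  proof (intro exI[of _ T] conjI ballI allI impI)
    show "is_tableau la T" by (simp add: is_tableau_def T_def)
  next
    fix x y assume x: "x \<in> young_diagram la" and y: "y \<in> young_diagram la"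
      and xy: "x \<noteq> y \<and> (fst x = fst y \<or> snd x = snd y)"
    obtain e where e: "e \<in> E" "x = (R e, C e)" using cell[OF x] by blast
    obtain e' where e': "e' \<in> E" "y = (R e', C e')" using cell[OF y] by blast
    show "T x \<noteq> T y"
    proof
      assume "T x = T y"
      then have S: "S e = S e'" using e e' G by (simp add: T_def)
      have "e = e'"
      proof (cases "fst x = fst y")
        case True
        then show ?thesis using e(2) e'(2) by (intro RSinj[OF e(1) e'(1) _ S]) simp
      next
        case False
        then show ?thesis using e(2) e'(2) xy by (intro CSinj[OF e(1) e'(1) _ S]) simp
      qed
      then show False using e e' xy by simp
    qed
  next
    fix i :: nat assume "1 \<le> i"
    then obtain t where t: "i = Suc t" by (cases i) auto
    define D where "D = {e \<in> E. S e = t}"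
    have "(\<lambda>e. (R e, C e)) ` D = {x \<in> young_diagram la. T x = i}"
    proof
      show "(\<lambda>e. (R e, C e)) ` D \<subseteq> {x \<in> young_diagram la. T x = i}"
        using G mem[OF RC] by (auto simp: D_def T_def t diag)
      show "{x \<in> young_diagram la. T x = i} \<subseteq> (\<lambda>e. (R e, C e)) ` D"
      proof
        fix x assume x: "x \<in> {x \<in> young_diagram la. T x = i}"
        then obtain e where "e \<in> E" "x = (R e, C e)" using cell by blast
        then show "x \<in> (\<lambda>e. (R e, C e)) ` D" using x G by (auto simp: D_def T_def t)
      qed
    qed
    moreover have "inj_on (\<lambda>e. (R e, C e)) D" by (rule inj_on_inverseI[of _ G]) (simp add: D_def G)
    ultimately have "card {x \<in> young_diagram la. T x = i} = card D" using card_image by metis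
    \<comment> \<open>Symbol \<open>t\<close> occurs at most once in a row, so counting its
      occurrences means counting the rows it meets, which by \<open>RS\<close> are those longer than
      \<open>t\<close>.\<close>
    also have "\<dots> = card (R ` D)"
    proof (rule card_image[symmetric], rule inj_onI)
      fix e e' assume "e \<in> D" "e' \<in> D" "R e = R e'"
      then show "e = e'" by (intro RSinj) (simp_all add: D_def)
    qed
    also have "R ` D = {r. t < part la r}"
    proof
      show "R ` D \<subseteq> {r. t < part la r}" using mem[OF RS] by (auto simp: D_def)
      show "{r. t < part la r} \<subseteq> R ` D"
      proof
        fix r assume "r \<in> {r. t < part la r}"
        then have "card {e \<in> E. R e = r \<and> S e = t} = 1" using RS by simp
        then have "{e \<in> E. R e = r \<and> S e = t} \<noteq> {}" by force
        then show "r \<in> R ` D" by (auto simp: D_def)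
      qed
    qed
    also have "card \<dots> = part (conjugate la) (i - 1)" using part_conjugate[OF la] t by simp
    finally show "card {x \<in> young_diagram la. T x = i} = part (conjugate la) (i - 1)" .
  qed
qed

section \<open>Partitions with three blocks\<close>

text \<open>Rows, columns and symbols are cut into the same three blocks, and the block pair
  \<open>(a, b)\<close> lies in the diagram exactly when \<open>a + b \<le> 2\<close>. This is
  symmetric, so one table \<open>l\<close> serves all three kinds of pairs.\<close>

lemma latin_three_blocks:
  assumes la: "is_partition la"
    and shape: "\<And>r. part la r =
      (if r < x then x + y + z else if r < x + y then x + y else if r < x + y + z then x else 0)"
    and zx: "z \<le> x" and ineq: "y * (x - y) \<le> x * (x - z)"
  shows "latin la"
proof -
  define w :: "nat \<Rightarrow> nat" where
    "w a = (if a = 0 then x else if a = 1 then y else if a = 2 then z else 0)" for a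
  define l :: "nat \<Rightarrow> nat \<Rightarrow> nat" where "l a b = of_bool (a + b \<le> 2)" for a b
  define off :: "nat \<Rightarrow> nat" where "off a = (if a = 0 then 0 else if a = 1 then x else x + y)" for a
  define cls :: "nat \<Rightarrow> nat" where "cls k = (if k < x then 0 else if k < x + y then 1 else 2)" for k
  define ix where "ix k = k - off (cls k)" for k
  \<comment> \<open>\<open>u\<close> is the number of triples of classes \<open>0, 0, 1\<close> in a given order; prescribing the pair
    counts then determines \<open>M\<close>, and this \<open>u\<close> is the least for which \<open>M 1 1 1\<close> is nonnegative.\<close>
  define u where "u = y * (x - y)"
  define M :: "nat \<Rightarrow> nat \<Rightarrow> nat \<Rightarrow> nat" where
    "M a b c = (if 2 \<in> {a, b, c} then if a + b + c = 2 then x * z else 0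
      else [x * (x - z) - u, u, x * y - u, y * y + u - x * y] ! (a + b + c))" for a b c
  \<comment> \<open>\<open>u1\<close>, \<open>u2\<close> and \<open>u3\<close> make the truncated
    subtractions in \<open>M\<close> exact; \<open>u1\<close> is where \<open>ineq\<close>
    enters.\<close>
  have u1: "u \<le> x * (x - z)" using ineq by (simp add: u_def)
  have u2: "u \<le> x * y" by (simp add: u_def mult.commute)
  have u3: "x * y \<le> y * y + u"
    by (cases "y \<le> x") (auto simp: u_def algebra_simps diff_mult_distrib2)
  have xx: "x * (x - z) + x * z = x * x" using zx by (simp add: diff_mult_distrib2)
  have M_sum: "M a b 0 + M a b 1 + M a b 2 = w a * w b * l a b"
    "M a 0 b + M a 1 b + M a 2 b = w a * w b * l a b"
    "M 0 a b + M 1 a b + M 2 a b = w a * w b * l a b"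
    if "a \<in> {0, 1, 2}" "b \<in> {0, 1, 2}" for a b
    using that u1 u2 u3 xx
    by (auto simp: M_def w_def l_def numeral_2_eq_2 numeral_3_eq_3 algebra_simps)
  define Cl where "Cl = {0, 1, 2 :: nat}"
  \<comment> \<open>Multiplicities become distinct elements by numbering the copies of each triple
    of classes.\<close>
  define E where "E = (SIGMA t : Cl \<times> Cl \<times> Cl. {..<M (fst t) (fst (snd t)) (snd (snd t))})"
  define R :: "(nat \<times> nat \<times> nat) \<times> nat \<Rightarrow> nat" where "R e = fst (fst e)" for e
  define C :: "(nat \<times> nat \<times> nat) \<times> nat \<Rightarrow> nat" where "C e = fst (snd (fst e))" for e
  define S :: "(nat \<times> nat \<times> nat) \<times> nat \<Rightarrow> nat" where "S e = snd (snd (fst e))" for e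
  note RCS = R_def C_def S_def
  have fin: "finite E" by (simp add: E_def Cl_def)
  have cl: "R e \<in> Cl" "C e \<in> Cl" "S e \<in> Cl" if "e \<in> E" for e
    using that by (auto simp: E_def RCS)
  have out: "w a * w b * l a b = 0" if "\<not> (a \<in> Cl \<and> b \<in> Cl)" for a b
    using that by (auto simp: Cl_def w_def)
  have RC: "card {e \<in> E. R e = a \<and> C e = b} = w a * w b * l a b" for a b
  proof (cases "a \<in> Cl \<and> b \<in> Cl")
    case True
    have "{e \<in> E. R e = a \<and> C e = b} =
        (SIGMA t : {a} \<times> {b} \<times> Cl. {..<M (fst t) (fst (snd t)) (snd (snd t))})"
      using True by (auto simp: E_def RCS)
    also have "card \<dots> = (\<Sum>c\<in>Cl. M a b c)"
      by (simp add: Cl_def insert_Times_insert)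
    finally show ?thesis using True M_sum(1)[of a b] by (simp add: Cl_def)
  next
    case False
    then have "{e \<in> E. R e = a \<and> C e = b} = {}" using cl by blast
    then show ?thesis by (simp only: card.empty out[OF False])
  qed
  have RS: "card {e \<in> E. R e = a \<and> S e = b} = w a * w b * l a b" for a b
  proof (cases "a \<in> Cl \<and> b \<in> Cl")
    case True
    have "{e \<in> E. R e = a \<and> S e = b} =
        (SIGMA t : {a} \<times> Cl \<times> {b}. {..<M (fst t) (fst (snd t)) (snd (snd t))})"
      using True by (auto simp: E_def RCS)
    also have "card \<dots> = (\<Sum>c\<in>Cl. M a c b)"
      by (simp add: Cl_def insert_Times_insert)
    finally show ?thesis using True M_sum(2)[of a b] by (simp add: Cl_def)
  next
    case False
    then have "{e \<in> E. R e = a \<and> S e = b} = {}" using cl by blast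
    then show ?thesis by (simp only: card.empty out[OF False])
  qed
  have CS: "card {e \<in> E. C e = a \<and> S e = b} = w a * w b * l a b" for a b
  proof (cases "a \<in> Cl \<and> b \<in> Cl")
    case True
    have "{e \<in> E. C e = a \<and> S e = b} =
        (SIGMA t : Cl \<times> {a} \<times> {b}. {..<M (fst t) (fst (snd t)) (snd (snd t))})"
      using True by (auto simp: E_def RCS)
    also have "card \<dots> = (\<Sum>c\<in>Cl. M c a b)"
      by (simp add: Cl_def insert_Times_insert)
    finally show ?thesis using True M_sum(3)[of a b] by (simp add: Cl_def)
  next
    case False
    then have "{e \<in> E. C e = a \<and> S e = b} = {}" using cl by blast
    then show ?thesis by (simp only: card.empty out[OF False])
  qed
  obtain r c s where rcs: "\<And>e. e \<in> E \<Longrightarrow> r e < w (R e)" "\<And>e. e \<in> E \<Longrightarrow> c e < w (C e)"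
      "\<And>e. e \<in> E \<Longrightarrow> s e < w (S e)"
    and pairs: "\<And>a b i j. i < w a \<Longrightarrow> j < w b \<Longrightarrow>
        card {e \<in> E. (R e, r e) = (a, i) \<and> (C e, c e) = (b, j)} = l a b"
      "\<And>a b i j. i < w a \<Longrightarrow> j < w b \<Longrightarrow>
        card {e \<in> E. (R e, r e) = (a, i) \<and> (S e, s e) = (b, j)} = l a b"
      "\<And>a b i j. i < w a \<Longrightarrow> j < w b \<Longrightarrow>
        card {e \<in> E. (C e, c e) = (a, i) \<and> (S e, s e) = (b, j)} = l a b"
    by (rule outline_detachment[OF fin RC RS CS]) blast
  \<comment> \<open>\<open>off a\<close> is where block \<open>a\<close> starts; \<open>cls\<close>
    and \<open>ix\<close> invert \<open>off a + i\<close>, turning an individual of a class into a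
    plain row, column or symbol number.\<close>
  have off_eq: "off a + i = k \<longleftrightarrow> k < x + y + z \<and> (a, i) = (cls k, ix k)"
    if "a \<in> Cl" "i < w a" for a i k
    using that by (auto simp: Cl_def off_def cls_def ix_def w_def)
  have ix_less: "ix k < w (cls k)" if "k < x + y + z" for k
    using that by (auto simp: off_def cls_def ix_def w_def)
  have part_iff: "j < part la i \<longleftrightarrow> i < x + y + z \<and> j < x + y + z \<and> cls i + cls j \<le> 2" for i j
    unfolding shape cls_def by auto
  \<comment> \<open>Arbitrary coordinates \<open>P\<close> and \<open>Q\<close>, so that one
    argument covers all three pairs of coordinates.\<close>
  have count: "card {e \<in> E. off (P e) + p e = i \<and> off (Q e) + q e = j} = of_bool (j < part la i)"
    if P: "\<And>e. e \<in> E \<Longrightarrow> P e \<in> Cl" "\<And>e. e \<in> E \<Longrightarrow> p e < w (P e)"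
      and Q: "\<And>e. e \<in> E \<Longrightarrow> Q e \<in> Cl" "\<And>e. e \<in> E \<Longrightarrow> q e < w (Q e)"
      and PQ: "\<And>a b i j. i < w a \<Longrightarrow> j < w b \<Longrightarrow>
        card {e \<in> E. (P e, p e) = (a, i) \<and> (Q e, q e) = (b, j)} = l a b"
    for P p Q q i j
  proof -
    have eq: "{e \<in> E. off (P e) + p e = i \<and> off (Q e) + q e = j} =
      {e \<in> E. (i < x + y + z \<and> (P e, p e) = (cls i, ix i)) \<and>
              (j < x + y + z \<and> (Q e, q e) = (cls j, ix j))}"
      using off_eq[OF P] off_eq[OF Q] by blast
    show ?thesis
    proof (cases "i < x + y + z \<and> j < x + y + z")
      case True
      then show ?thesis
        using PQ[OF ix_less ix_less, of i j] by (simp add: eq part_iff l_def)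
    next
      case False
      then have "{e \<in> E. off (P e) + p e = i \<and> off (Q e) + q e = j} = {}" unfolding eq by blast
      then show ?thesis using False by (simp only: part_iff) auto
    qed
  qed
  show ?thesis
    by (rule latin_from_triples[OF la, where E = E and R = "\<lambda>e. off (R e) + r e"
          and C = "\<lambda>e. off (C e) + c e" and S = "\<lambda>e. off (S e) + s e"])
      (intro count cl rcs pairs fin; assumption)+
qed

section \<open>Block sizes and inequalities from the hypotheses\<close>

lemma self_conjugate_part_iff:
  assumes "is_partition la" "conjugate la = la"
  shows "i < part la r \<longleftrightarrow> r < part la i"
  using row_set_eq[OF assms(1), of i] assms(2) by auto

text \<open>The smallest part \<open>x\<close> is by symmetry also the number of rows of full length
  \<open>n\<close>. The next row has length \<open>m\<close>, which by symmetry is the number of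
  rows longer than \<open>x\<close>.\<close>

lemma self_conjugate_three_blocks:
  assumes la: "is_partition la" and sc: "conjugate la = la" and three: "card (set la) \<le> 3"
  obtains x y z where "length la = x + y + z" "x = 0 \<Longrightarrow> la = []"
    "\<And>r. part la r =
      (if r < x then x + y + z else if r < x + y then x + y else if r < x + y + z then x else 0)"
proof (cases "la = []")
  case True
  then show ?thesis using that[of 0 0 0] by (simp add: part_def)
next
  case False
  define n where "n = length la"
  have n: "n > 0" using False by (simp add: n_def)
  note sym = self_conjugate_part_iff[OF la sc] and anti = part_antimono[OF la]
  have zero: "part la r = 0" if "n \<le> r" for r using that by (simp add: part_def n_def)
  have "r < part la 0 \<longleftrightarrow> r < n" for r using sym[of r 0] part_pos_iff[OF la, of r] by (simp add: n_def)
  then have p0: "part la 0 = n" by (metis linorder_neqE_nat less_irrefl)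
  define x where "x = part la (n - 1)"
  have x0: "x > 0" using part_pos_iff[OF la, of "n - 1"] n by (simp add: x_def n_def)
  have xn: "x \<le> n" using anti[of 0 "n - 1"] p0 by (simp add: x_def)
  have top: "part la r = n" if "r < x" for r
  proof -
    have "n - 1 < part la r" using sym[of r "n - 1"] that by (simp add: x_def)
    moreover have "part la r \<le> n" using anti[of 0 r] p0 by simp
    ultimately show ?thesis by simp
  qed
  show ?thesis
  proof (cases "x = n")
    case True
    then show ?thesis using that[of x 0 0] top zero False x0 by (simp add: n_def)
  next
    case False
    then have xn': "x < n" using xn by simp
    define m where "m = part la x"
    have xm: "x \<le> m" using anti[of x "n - 1"] xn' by (simp add: m_def x_def)
    \<comment> \<open>By symmetry, a full row \<open>x\<close> would make the last row longer than
      \<open>x\<close>.\<close>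
    have "\<not> n - 1 < part la x" using sym[of x "n - 1"] by (simp add: x_def)
    then have mn: "m < n" using n by (simp add: m_def)
    have mid: "part la r = m" if r: "x \<le> r" "r < m" for r
    proof (rule ccontr)
      assume "part la r \<noteq> m"
      then have less: "part la r < m" using anti[OF r(1)] by (simp add: m_def)
      have gr: "x < part la r" using sym[of x r] r by (simp add: m_def)
      have mem: "part la i \<in> set la" if "i < n" for i using that by (simp add: part_def n_def)
      \<comment> \<open>A deviating row between \<open>x\<close> and \<open>m\<close> would produce
        a fourth part size.\<close>
      have "{n, m, part la r, x} \<subseteq> set la"
        using mem[of 0] mem[of x] mem[of r] mem[of "n - 1"] p0 xn' r mn
        by (simp add: m_def x_def)
      then have "card {n, m, part la r, x} \<le> card (set la)" by (intro card_mono) auto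
      moreover have "card {n, m, part la r, x} = 4" using less gr mn by simp
      ultimately show False using three by simp
    qed
    have low: "part la r = x" if r: "m \<le> r" "r < n" for r
    proof -
      have "\<not> x < part la r" using sym[of x r] r by (simp add: m_def)
      moreover have "x \<le> part la r" using anti[of r "n - 1"] r by (simp add: x_def)
      ultimately show ?thesis by simp
    qed
    show ?thesis
    proof (rule that[of x "m - x" "n - m"])
      show "length la = x + (m - x) + (n - m)" using xm mn by (simp add: n_def)
      show "la = []" if "x = 0" using that x0 by simp
      show "part la r = (if r < x then x + (m - x) + (n - m) else if r < x + (m - x) then x + (m - x)
        else if r < x + (m - x) + (n - m) then x else 0)" for r
        using xm mn top mid low zero by auto
    qed
  qed
qed

lemma wide_three_blocks:
  assumes la: "is_partition la" and "wide la" and len: "length la = x + y + z" and x: "x > 0"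
    and shape: "\<And>r. part la r =
      (if r < x then x + y + z else if r < x + y then x + y else if r < x + y + z then x else 0)"
  shows "z \<le> x" and "y * (x - y) \<le> x * (x - z)"
proof -
  \<comment> \<open>The two inequalities are dominance for this subpartition at \<open>j = 1\<close> and \<open>j = x\<close>.\<close>
  define mu where "mu = drop x la"
  have mu: "is_partition mu"
    using la unfolding mu_def is_partition_def by (auto simp: sorted_wrt_drop dest: in_set_dropD)
  have "mset la = mset (take x la) + mset mu" unfolding mu_def by (metis append_take_drop_id mset_append)
  then have "subpartition mu la" using mu by (simp add: subpartition_def)
  then have "dominates mu (conjugate mu)" using \<open>wide la\<close> by (simp add: wide_def)
  then have dom: "(\<Sum>k<j. part (conjugate mu) k) \<le> (\<Sum>k<j. part mu k)" for j
    by (simp add: dominates_def)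
  have part_mu: "part mu k = (if k < y then x + y else if k < y + z then x else 0)" for k
    using shape[of "x + k"] len by (auto simp: mu_def part_def split: if_splits)
  \<comment> \<open>The first \<open>x\<close> columns of \<open>mu\<close> meet all its
    \<open>y + z\<close> rows, as each has length at least \<open>x\<close>.\<close>
  have conj_mu: "part (conjugate mu) k = y + z" if "k < x" for k
  proof -
    have "{r. k < part mu r} = {..<y + z}" using that by (auto simp: part_mu split: if_splits)
    then show ?thesis using part_conjugate[OF mu] by simp
  qed
  have "y + z \<le> part mu 0" using dom[of 1] conj_mu[OF x] by (simp add: lessThan_Suc)
  then show zx: "z \<le> x" by (auto simp: part_mu split: if_splits)
  show "y * (x - y) \<le> x * (x - z)"
  \<comment> \<open>For \<open>y > x\<close> the truncated difference \<open>x - y\<close> is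
    0.\<close>
  proof (cases "y \<le> x")
    case True
    have "x * (y + z) = (\<Sum>k<x. part (conjugate mu) k)" using conj_mu by simp
    also have "\<dots> \<le> (\<Sum>k<x. part mu k)" by (rule dom)
    \<comment> \<open>This bound evaluates to \<open>x * x + y * y\<close>, since
      \<open>y \<le> x\<close> puts all \<open>y\<close> longer rows among the first
      \<open>x\<close>.\<close>
    also have "\<dots> \<le> (\<Sum>k<x. x + (if k < y then y else 0))" by (intro sum_mono) (simp add: part_mu)
    also have "\<dots> = x * x + y * card ({..<x} \<inter> {k. k < y})"
      by (simp add: sum.distrib sum.If_cases)
    also have "{..<x} \<inter> {k. k < y} = {..<y}" using True by auto
    finally have "x * y + x * z \<le> x * x + y * y" by (simp add: algebra_simps)
    moreover have "x * (x - z) + x * z = x * x" using zx by (simp add: diff_mult_distrib2)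
    moreover have "y * (x - y) + y * y = x * y" using True by (simp add: diff_mult_distrib2 mult.commute)
    ultimately show ?thesis by linarith
  qed simp
qed

theorem theorem5:
  fixes la :: "nat list"
  assumes "is_partition la"
    and "conjugate la = la"
    and "wide la"
    and "card (set la) \<le> 3"
  shows "latin la"
proof -
  obtain x y z where xyz: "length la = x + y + z" "x = 0 \<Longrightarrow> la = []"
    "\<And>r. part la r =
      (if r < x then x + y + z else if r < x + y then x + y else if r < x + y + z then x else 0)"
    by (rule self_conjugate_three_blocks[OF assms(1,2,4)]) blast
  have "z \<le> x \<and> y * (x - y) \<le> x * (x - z)"
  proof (cases "x = 0")
    case True
    then show ?thesis using xyz(1,2) by simp
  next
    case False
    then show ?thesis using wide_three_blocks[OF assms(1,3) xyz(1) _ xyz(3)] by simp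
  qed
  then show ?thesis using latin_three_blocks[OF assms(1) xyz(3)] by blast
qed

end
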